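(* Let $\alpha>0$, $B\in\mathbb{R}$, and let $w:\{0,1,2,\dots\}\to(0,\infty)$ satisfy $\frac{1}{w(n)}=n^{\alpha}\left(1+\frac{2B}{n}+O\left(\frac{1}{n^2}\right)\right)$ as $n\to\infty$. Let $*\in\{-,+,0\}$ and let $(\mathfrak{B}_n,\mathfrak{R}_n)_{n\ge 0}=(\mathfrak{B}^*_n,\mathfrak{R}^*_n)_{n\ge0}$ be the generalized Pólya urn process of type $*$ associated with $w$, with $\mathfrak{D}_n=\mathfrak{R}_n-\mathfrak{B}_n$ and $\tau_n^{\mathfrak{B}}$ the number of draws until the $n$-th blue ball is drawn. Then there exist constants $C_1,c_1>0$ such that for all integers $n,m\ge 1$, $$\mathbb{P}\left(|\mathfrak{D}_{\tau_n^{\mathfrak{B}}}|\ge m\right)\le C_1 e^{\frac{-c_1m^2}{m\vee n}}\quad\text{and}\quad \mathbb{P}\left(|\mathfrak{D}_n|\ge m\right)\le C_1e^{\frac{-c_1m^2}{m\vee n}}.$$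
   Context: No monotonicity of $w$ is assumed. Given sequences of positive numbers $\{b(i)\}_{i\ge0}$ and $\{r(i)\}_{i\ge0}$, the generalized Pólya urn process $\{(\mathfrak{B}_n,\mathfrak{R}_n)\}_{n\ge0}$ is the Markov chain on $\{0,1,2,\dots\}^2$ started at $(0,0)$ which from state $(i,j)$ moves to $(i+1,j)$ with probability $\frac{b(i)}{b(i)+r(j)}$ and to $(i,j+1)$ with probability $\frac{r(j)}{b(i)+r(j)}$. Here $\mathfrak{B}_n$ and $\mathfrak{R}_n$ are the numbers of blue and red balls drawn in the first $n$ draws. For $*\in\{-,+,0\}$, the urn process of type $*$ associated with $w$, denoted $(\mathfrak{B}^*_n,\mathfrak{R}^*_n)_{n\ge0}$, is the one with $b=b^*$, $r=r^*$, where for $i\ge0$: $b^-(i)=w(2i)$, $r^-(i)=w(2i+1)$; $b^+(i)=w(2i+1)$, $r^+(i)=w(2i)$; $b^0(i)=r^0(i)=w(2i)$. The discrepancy is $\mathfrak{D}^*_n=\mathfrak{R}^*_n-\mathfrak{B}^*_n$. The times $\tau_k^{\mathfrak{B}^*}$ are defined by $\tau_0^{\mathfrak{B}^*}=0$ and $\tau_k^{\mathfrak{B}^*}=\inf\{n>\tau_{k-1}^{\mathfrak{B}^*}:\mathfrak{B}^*_n=\mathfrak{B}^*_{n-1}+1\}$ for $k\ge1$. The superscript $*$ is dropped in the claim. Notation: $m\vee n=\max(m,n)$. *)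

theory Defs
  imports "HOL-Probability.Probability" "HOL-Library.Landau_Symbols" "HOL-Library.Extended_Nat"
begin

text \<open>
  Time-homogeneous Markov chains on a discrete state space, on an arbitrary probability space:
  \<^term>\<open>K x y\<close> is the probability of moving from \<^term>\<open>x\<close> to \<^term>\<open>y\<close>.
\<close>

definition markov_chain_from ::
    "'a measure \<Rightarrow> ('s \<Rightarrow> 's \<Rightarrow> real) \<Rightarrow> 's \<Rightarrow> (nat \<Rightarrow> 'a \<Rightarrow> 's) \<Rightarrow> bool" where
  "markov_chain_from M K x0 X \<longleftrightarrow>
     prob_space M \<and>
     (\<forall>n. X n \<in> measurable M (count_space UNIV)) \<and>
     (AE \<omega> in M. X 0 \<omega> = x0) \<and>
     (\<forall>n x y. \<P>(\<omega> in M. \<forall>k\<le>n. X k \<omega> = x k) > 0 \<longrightarrow>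
        \<P>(\<omega> in M. X (Suc n) \<omega> = y \<bar> \<forall>k\<le>n. X k \<omega> = x k) = K (x n) y)"

text \<open>States are pairs (blue draws, red draws).\<close>

definition urn_transition ::
    "(nat \<Rightarrow> real) \<Rightarrow> (nat \<Rightarrow> real) \<Rightarrow> nat \<times> nat \<Rightarrow> nat \<times> nat \<Rightarrow> real" where
  "urn_transition b r = (\<lambda>(i, j) y.
     if y = (Suc i, j) then b i / (b i + r j)
     else if y = (i, Suc j) then r j / (b i + r j)
     else 0)"

definition urn_process ::
    "'a measure \<Rightarrow> (nat \<Rightarrow> real) \<Rightarrow> (nat \<Rightarrow> real) \<Rightarrow> (nat \<Rightarrow> 'a \<Rightarrow> nat \<times> nat) \<Rightarrow> bool" where
  "urn_process M b r X \<longleftrightarrow> markov_chain_from M (urn_transition b r) (0, 0) X"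

datatype urn_type = Minus | Plus | Zero

fun blue_weight :: "urn_type \<Rightarrow> (nat \<Rightarrow> real) \<Rightarrow> nat \<Rightarrow> real" where
  "blue_weight Minus w i = w (2 * i)"
| "blue_weight Plus w i = w (2 * i + 1)"
| "blue_weight Zero w i = w (2 * i)"

fun red_weight :: "urn_type \<Rightarrow> (nat \<Rightarrow> real) \<Rightarrow> nat \<Rightarrow> real" where
  "red_weight Minus w i = w (2 * i + 1)"
| "red_weight Plus w i = w (2 * i)"
| "red_weight Zero w i = w (2 * i)"

definition urn_process_of_type ::
    "'a measure \<Rightarrow> urn_type \<Rightarrow> (nat \<Rightarrow> real) \<Rightarrow> (nat \<Rightarrow> 'a \<Rightarrow> nat \<times> nat) \<Rightarrow> bool" where
  "urn_process_of_type M t w X \<longleftrightarrow> urn_process M (blue_weight t w) (red_weight t w) X"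

definition discrepancy :: "(nat \<Rightarrow> 'a \<Rightarrow> nat \<times> nat) \<Rightarrow> nat \<Rightarrow> 'a \<Rightarrow> int" where
  "discrepancy X n \<omega> = int (snd (X n \<omega>)) - int (fst (X n \<omega>))"

text \<open>
  The time of the \<open>k\<close>-th blue draw. The infimum of the empty set is \<^term>\<open>\<infinity> :: enat\<close>.
  The truncated subtraction \<open>n - 1\<close> is harmless, since only \<open>n > 0\<close> is considered.
\<close>

fun blue_time :: "(nat \<Rightarrow> 'a \<Rightarrow> nat \<times> nat) \<Rightarrow> nat \<Rightarrow> 'a \<Rightarrow> enat" where
  "blue_time X 0 \<omega> = 0"
| "blue_time X (Suc k) \<omega> =
     Inf {enat n |n. blue_time X k \<omega> < enat n \<and> fst (X n \<omega>) = fst (X (n - 1) \<omega>) + 1}"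

text \<open>
  The event that the absolute discrepancy at a random time is at least \<open>m\<close>. Outcomes for which
  the time is infinite are counted as belonging to it, so that an upper bound on its probability
  holds whatever value is given to the discrepancy at an infinite time.
\<close>

definition discrepancy_at_ge ::
    "(nat \<Rightarrow> 'a \<Rightarrow> nat \<times> nat) \<Rightarrow> ('a \<Rightarrow> enat) \<Rightarrow> nat \<Rightarrow> 'a \<Rightarrow> bool" where
  "discrepancy_at_ge X T m \<omega> \<longleftrightarrow>
     T \<omega> = \<infinity> \<or> \<bar>discrepancy X (the_enat (T \<omega>)) \<omega>\<bar> \<ge> int m"

end

theory Submission
  imports Defs
begin

text \<open>
  The discrepancy never grows faster than a simple random walk. The weights decrease roughly
  like \<open>n powr -\<alpha>\<close>, so the colour that has been drawn more often is, up to an error of relative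
  size \<open>O(1/n)\<close>, the less likely one. Hence the step of \<open>D\<close> after \<open>n\<close> draws has a mean that points away
  from \<open>0\<close> by at most \<open>C/(n+1)\<close>. The pull back towards \<open>0\<close> is simply discarded. All that survives of
  the asymptotics of \<open>w\<close> is the bound \<open>w q \<le> w p * (1 + C/(p+q+1))\<close> for \<open>p \<le> q + 1\<close>
  (\<open>weight_ratio_le\<close>); all three urn types fit under it, since at state \<open>(i, j)\<close> they read off weights
  whose indices differ by at most one from \<open>2i\<close> and \<open>2j\<close>.

  The even function \<open>cosh (l * D)\<close> tests both tails at once. One step multiplies its expectation by
  at most \<open>exp (l\<^sup>2/2 + C*l/(n+1))\<close> (\<open>cosh_step_le\<close>): the first term is the cost of a fair \<open>\<pm>1\<close> step, the
  second that of the bias. The biases add up to \<open>C*l\<close> times a harmonic sum, for which the crude bound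
  \<open>2 * sqrt n\<close> is enough: with \<open>N = max m n\<close> and \<open>l = m/N\<close> it costs a multiple of \<open>x = m / sqrt N\<close> in
  the exponent, which is absorbed by the main term \<open>-x\<^sup>2/2\<close> at the price of a constant
  (\<open>urn_discrepancy_tail\<close>).

  The discrepancy at the time of the \<open>n\<close>-th blue draw reduces to two deterministic times. If at least
  \<open>n + m\<close> red balls precede the \<open>n\<close>-th blue one, or if that draw never takes place, then fewer than
  \<open>n\<close> blue balls are seen in the first \<open>2n + m - 1\<close> draws; if at most \<open>n - m\<close> red balls precede it,
  then \<open>n\<close> blue balls are seen in the first \<open>2n - m\<close> draws. Either way the discrepancy at that
  deterministic time is at least \<open>m\<close> in absolute value (\<open>discrepancy_at_blue_time_imp\<close>).
\<close>

section \<open>One step of a Markov chain on a countable space\<close>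

lemma markov_chain_path_step:
  assumes "markov_chain_from M K x0 X"
  shows "emeasure M {\<omega> \<in> space M. (\<forall>k\<le>n. X k \<omega> = x k) \<and> X (Suc n) \<omega> = y}
       = emeasure M {\<omega> \<in> space M. \<forall>k\<le>n. X k \<omega> = x k} * ennreal (K (x n) y)"
proof -
  interpret prob_space M
    using assms by (simp add: markov_chain_from_def)
  have X[measurable]: "X k \<in> measurable M (count_space UNIV)" for k
    using assms by (simp add: markov_chain_from_def)
  define A where "A = {\<omega> \<in> space M. \<forall>k\<le>n. X k \<omega> = x k}"
  define A' where "A' = {\<omega> \<in> space M. (\<forall>k\<le>n. X k \<omega> = x k) \<and> X (Suc n) \<omega> = y}"
  have [measurable]: "A \<in> sets M" "A' \<in> sets M"
    unfolding A_def A'_def by measurable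
  have sub: "A' \<subseteq> A" by (auto simp: A_def A'_def)
  have "emeasure M A' = emeasure M A * ennreal (K (x n) y)"
  proof (cases "measure M A > 0")
    case True
    have "{\<omega> \<in> space M. X (Suc n) \<omega> = y \<and> (\<forall>k\<le>n. X k \<omega> = x k)} = A'"
      by (auto simp: A'_def)
    then have "measure M A' / measure M A = K (x n) y"
      using assms True by (auto simp: markov_chain_from_def cond_prob_def A_def)
    moreover from this have "K (x n) y \<ge> 0"
      by (metis measure_nonneg divide_nonneg_nonneg)
    ultimately have "measure M A' = measure M A * K (x n) y" "K (x n) y \<ge> 0"
      using True by (auto simp: field_simps)
    then show ?thesis
      by (simp add: emeasure_eq_measure ennreal_mult)
  next
    case False
    then have "measure M A = 0"
      by (simp add: zero_less_measure_iff)
    moreover have "measure M A' \<le> measure M A"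
      using sub by (intro finite_measure_mono) auto
    ultimately show ?thesis
      by (simp add: emeasure_eq_measure measure_le_0_iff)
  qed
  then show ?thesis by (simp add: A_def A'_def)
qed

text \<open>
  Used twice to turn an expectation into a sum over elementary events: over the possible pasts of a
  chain, and over its possible next states.
\<close>

lemma nn_integral_countable_partition:
  assumes I: "countable I" and f[measurable]: "f \<in> borel_measurable M"
    and A: "\<And>i. i \<in> I \<Longrightarrow> {\<omega> \<in> space M. Y \<omega> = i} \<in> sets M"
    and Y: "\<And>\<omega>. \<omega> \<in> space M \<Longrightarrow> Y \<omega> \<in> I"
  shows "(\<integral>\<^sup>+\<omega>. f \<omega> \<partial>M)
       = (\<integral>\<^sup>+i. (\<integral>\<^sup>+\<omega>. f \<omega> * indicator {\<omega> \<in> space M. Y \<omega> = i} \<omega> \<partial>M) \<partial>count_space I)"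
proof -
  have "(\<integral>\<^sup>+i. f \<omega> * indicator {\<omega> \<in> space M. Y \<omega> = i} \<omega> \<partial>count_space I) = f \<omega>"
    if "\<omega> \<in> space M" for \<omega>
    using that Y[OF that]
    by (subst nn_integral_count_space'[where A = "{Y \<omega>}"]) auto
  then have "(\<integral>\<^sup>+\<omega>. f \<omega> \<partial>M)
     = (\<integral>\<^sup>+\<omega>. (\<integral>\<^sup>+i. f \<omega> * indicator {\<omega> \<in> space M. Y \<omega> = i} \<omega> \<partial>count_space I) \<partial>M)"
    by (intro nn_integral_cong) simp
  also have "\<dots> = (\<integral>\<^sup>+i. (\<integral>\<^sup>+\<omega>. f \<omega> * indicator {\<omega> \<in> space M. Y \<omega> = i} \<omega> \<partial>M) \<partial>count_space I)"
    using A by (intro nn_integral_count_space_nn_integral I) auto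
  finally show ?thesis .
qed

text \<open>
  The chain is given by conditioning on whole paths. There are only countably many paths up to
  time \<open>n\<close>, and on each of them the conditional law of the next state is \<open>K (X n)\<close>; summing over the
  paths removes the conditioning. Letting \<open>f\<close> depend on both states makes the formula yield
  expectations of functions of the next state as well as almost sure statements on the transition.
\<close>

lemma markov_chain_nn_integral_step:
  fixes X :: "nat \<Rightarrow> 'a \<Rightarrow> 's :: countable" and f :: "'s \<Rightarrow> 's \<Rightarrow> ennreal"
  assumes mc: "markov_chain_from M K x0 X"
  shows "(\<integral>\<^sup>+\<omega>. f (X n \<omega>) (X (Suc n) \<omega>) \<partial>M)
       = (\<integral>\<^sup>+\<omega>. (\<integral>\<^sup>+y. ennreal (K (X n \<omega>) y) * f (X n \<omega>) y \<partial>count_space UNIV) \<partial>M)"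
proof -
  interpret prob_space M
    using assms by (simp add: markov_chain_from_def)
  have X[measurable]: "X k \<in> measurable M (count_space UNIV)" for k
    using assms by (simp add: markov_chain_from_def)
  define P where "P = (PiE {..n} (\<lambda>_. UNIV :: 's set))"
  define Y where "Y \<omega> = restrict (\<lambda>k. X k \<omega>) {..n}" for \<omega>
  define A where "A p = {\<omega> \<in> space M. Y \<omega> = p}" for p
  define g where "g x = (\<integral>\<^sup>+y. ennreal (K x y) * f x y \<partial>count_space UNIV)" for x
  have P: "countable P" unfolding P_def by (intro countable_PiE) auto
  have Y_iff: "Y \<omega> = p \<longleftrightarrow> (\<forall>k\<le>n. X k \<omega> = p k)" if "p \<in> P" for \<omega> p
    using that by (auto simp: Y_def P_def PiE_def extensional_def restrict_def fun_eq_iff)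
  have A_eq: "A p = {\<omega> \<in> space M. \<forall>k\<le>n. X k \<omega> = p k}" if "p \<in> P" for p
    using Y_iff[OF that] by (auto simp: A_def)
  have A[measurable]: "A p \<in> sets M" if "p \<in> P" for p
    unfolding A_eq[OF that] by measurable
  have YP: "Y \<omega> \<in> P" for \<omega> by (auto simp: Y_def P_def)
  have m2[measurable]: "(\<lambda>\<omega>. f (X n \<omega>) (X (Suc n) \<omega>)) \<in> borel_measurable M"
  proof -
    have "(\<lambda>\<omega>. (X n \<omega>, X (Suc n) \<omega>)) \<in> measurable M (count_space UNIV \<Otimes>\<^sub>M count_space UNIV)"
      by measurable
    then have "(\<lambda>\<omega>. (X n \<omega>, X (Suc n) \<omega>)) \<in> measurable M (count_space UNIV)"
      by (simp add: pair_measure_countable)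
    then have "(\<lambda>\<omega>. (\<lambda>(x, y). f x y) (X n \<omega>, X (Suc n) \<omega>)) \<in> borel_measurable M"
      by (rule measurable_compose) simp
    then show ?thesis by simp
  qed
  have m1[measurable]: "(\<lambda>\<omega>. g (X n \<omega>)) \<in> borel_measurable M"
    by (rule measurable_compose[OF X]) simp
  have cell: "(\<integral>\<^sup>+\<omega>. f (X n \<omega>) (X (Suc n) \<omega>) * indicator (A p) \<omega> \<partial>M)
      = (\<integral>\<^sup>+\<omega>. g (X n \<omega>) * indicator (A p) \<omega> \<partial>M)" if p: "p \<in> P" for p
  proof -
    note [measurable] = A[OF p]
    have "(\<integral>\<^sup>+\<omega>. f (X n \<omega>) (X (Suc n) \<omega>) * indicator (A p) \<omega> \<partial>M)
       = (\<integral>\<^sup>+y. (\<integral>\<^sup>+\<omega>. f (X n \<omega>) (X (Suc n) \<omega>) * indicator (A p) \<omega>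
             * indicator {\<omega> \<in> space M. X (Suc n) \<omega> = y} \<omega> \<partial>M) \<partial>count_space UNIV)"
      by (rule nn_integral_countable_partition) auto
    also have "\<dots> = (\<integral>\<^sup>+y. f (p n) y * emeasure M {\<omega> \<in> space M. (\<forall>k\<le>n. X k \<omega> = p k) \<and> X (Suc n) \<omega> = y}
           \<partial>count_space UNIV)"
    proof (intro nn_integral_cong)
      fix y
      have "(\<integral>\<^sup>+\<omega>. f (X n \<omega>) (X (Suc n) \<omega>) * indicator (A p) \<omega>
             * indicator {\<omega> \<in> space M. X (Suc n) \<omega> = y} \<omega> \<partial>M)
        = (\<integral>\<^sup>+\<omega>. f (p n) y *
           indicator {\<omega> \<in> space M. (\<forall>k\<le>n. X k \<omega> = p k) \<and> X (Suc n) \<omega> = y} \<omega> \<partial>M)"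
        by (intro nn_integral_cong) (auto simp: A_eq[OF p] split: split_indicator)
      then show "(\<integral>\<^sup>+\<omega>. f (X n \<omega>) (X (Suc n) \<omega>) * indicator (A p) \<omega>
             * indicator {\<omega> \<in> space M. X (Suc n) \<omega> = y} \<omega> \<partial>M)
        = f (p n) y * emeasure M {\<omega> \<in> space M. (\<forall>k\<le>n. X k \<omega> = p k) \<and> X (Suc n) \<omega> = y}"
        by (simp add: nn_integral_cmult_indicator)
    qed
    also have "\<dots> = (\<integral>\<^sup>+y. emeasure M (A p) * (ennreal (K (p n) y) * f (p n) y) \<partial>count_space UNIV)"
      unfolding markov_chain_path_step[OF mc] A_eq[OF p] by (simp add: mult_ac)
    also have "\<dots> = emeasure M (A p) * g (p n)"
      unfolding g_def by (rule nn_integral_cmult) simp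
    also have "\<dots> = (\<integral>\<^sup>+\<omega>. g (p n) * indicator (A p) \<omega> \<partial>M)"
      by (simp add: nn_integral_cmult_indicator mult_ac)
    also have "\<dots> = (\<integral>\<^sup>+\<omega>. g (X n \<omega>) * indicator (A p) \<omega> \<partial>M)"
      by (intro nn_integral_cong) (auto simp: A_eq[OF p] split: split_indicator)
    finally show ?thesis .
  qed
  have "(\<integral>\<^sup>+\<omega>. f (X n \<omega>) (X (Suc n) \<omega>) \<partial>M)
      = (\<integral>\<^sup>+p. (\<integral>\<^sup>+\<omega>. f (X n \<omega>) (X (Suc n) \<omega>) * indicator (A p) \<omega> \<partial>M) \<partial>count_space P)"
    unfolding A_def by (rule nn_integral_countable_partition) (use P A YP in \<open>auto simp: A_def\<close>)
  also have "\<dots> = (\<integral>\<^sup>+p. (\<integral>\<^sup>+\<omega>. g (X n \<omega>) * indicator (A p) \<omega> \<partial>M) \<partial>count_space P)"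
    by (rule nn_integral_cong) (simp add: cell)
  also have "\<dots> = (\<integral>\<^sup>+\<omega>. g (X n \<omega>) \<partial>M)"
    unfolding A_def by (rule nn_integral_countable_partition[symmetric]) (use P A YP in \<open>auto simp: A_def\<close>)
  finally show ?thesis by (simp add: g_def)
qed

text \<open>
  The indicator of a forbidden transition has expectation zero by the formula above.
\<close>

lemma markov_chain_AE_transition:
  fixes X :: "nat \<Rightarrow> 'a \<Rightarrow> 's :: countable"
  assumes mc: "markov_chain_from M K x0 X"
  shows "AE \<omega> in M. \<forall>n. K (X n \<omega>) (X (Suc n) \<omega>) \<noteq> 0"
proof -
  have X[measurable]: "X k \<in> measurable M (count_space UNIV)" for k
    using assms by (simp add: markov_chain_from_def)
  have "AE \<omega> in M. K (X n \<omega>) (X (Suc n) \<omega>) \<noteq> 0" for n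
  proof -
    define f :: "'s \<Rightarrow> 's \<Rightarrow> ennreal" where "f x y = (if K x y = 0 then 1 else 0)" for x y
    have "(\<lambda>\<omega>. (X n \<omega>, X (Suc n) \<omega>)) \<in> measurable M (count_space UNIV \<Otimes>\<^sub>M count_space UNIV)"
      by measurable
    then have "(\<lambda>\<omega>. (X n \<omega>, X (Suc n) \<omega>)) \<in> measurable M (count_space UNIV)"
      by (simp add: pair_measure_countable)
    then have "(\<lambda>\<omega>. (\<lambda>(x, y). f x y) (X n \<omega>, X (Suc n) \<omega>)) \<in> borel_measurable M"
      by (rule measurable_compose) simp
    moreover have "ennreal (K x y) * f x y = 0" for x y
      by (simp add: f_def)
    then have "(\<integral>\<^sup>+\<omega>. f (X n \<omega>) (X (Suc n) \<omega>) \<partial>M) = 0"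
      unfolding markov_chain_nn_integral_step[OF mc] by (simp only: nn_integral_const mult_zero_left)
    ultimately have "AE \<omega> in M. f (X n \<omega>) (X (Suc n) \<omega>) = 0"
      by (simp add: nn_integral_0_iff_AE)
    then show ?thesis
      by eventually_elim (auto simp: f_def split: if_splits)
  qed
  then show ?thesis by (simp add: AE_all_countable)
qed

section \<open>Ratios of weights\<close>

lemma exp_minus_one_le: "exp x \<le> 1 + x * exp x" for x :: real
proof -
  have "(1 - x) * exp x \<le> exp (- x) * exp x"
    using exp_ge_add_one_self[of "- x"] by (intro mult_right_mono) auto
  also have "\<dots> = 1" by (simp add: exp_minus)
  finally show ?thesis by (simp add: algebra_simps)
qed

lemma scaled_weight_near_one:
  fixes w :: "nat \<Rightarrow> real"
  assumes pos: "\<And>n. w n > 0"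
    and O: "e \<in> O(\<lambda>n. 1 / (real n)\<^sup>2)"
    and ev: "\<forall>\<^sub>F n in sequentially. 1 / w n = real n powr \<alpha> * (1 + 2 * B / real n + e n)"
  shows "\<exists>L > 0. \<forall>\<^sub>F n in sequentially. \<bar>real n powr \<alpha> * w n - 1\<bar> \<le> L / real n"
proof -
  obtain c where c: "c > 0" "\<forall>\<^sub>F n in sequentially. norm (e n) \<le> c * norm (1 / (real n)\<^sup>2)"
    using O by (rule landau_o.bigE)
  define K where "K = 2 * \<bar>B\<bar> + c"
  have K: "K > 0" using c by (simp add: K_def)
  have "\<forall>\<^sub>F n in sequentially. real n \<ge> max 1 (2 * K)"
    by (rule filterlim_at_top[THEN iffD1, rule_format, OF filterlim_real_sequentially])
  then have "\<forall>\<^sub>F n in sequentially. \<bar>real n powr \<alpha> * w n - 1\<bar> \<le> 2 * K / real n"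
    using ev c(2)
  proof eventually_elim
    case (elim n)
    define \<delta> where "\<delta> = 2 * B / real n + e n"
    have n: "real n \<ge> 1" "real n \<ge> 2 * K" using elim(1) by auto
    have "\<bar>e n\<bar> \<le> c / (real n)\<^sup>2" using elim(3) by simp
    also have "\<dots> \<le> c / real n"
      using c(1) n self_le_power[of "real n" 2] by (intro divide_left_mono) auto
    finally have "\<bar>\<delta>\<bar> \<le> \<bar>2 * B / real n\<bar> + c / real n"
      unfolding \<delta>_def by linarith
    also have "\<dots> = K / real n" by (simp add: K_def abs_mult add_divide_distrib)
    finally have \<delta>: "\<bar>\<delta>\<bar> \<le> K / real n" .
    also have "K / real n \<le> 1 / 2" using n by (simp add: field_simps)
    finally have half: "\<bar>\<delta>\<bar> \<le> 1 / 2" .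
    have "1 / w n = real n powr \<alpha> * (1 + \<delta>)" using elim(2) by (simp add: \<delta>_def add.assoc)
    then have "real n powr \<alpha> * w n = 1 / (1 + \<delta>)"
      using pos[of n] half by (simp add: field_simps)
    then have "\<bar>real n powr \<alpha> * w n - 1\<bar> = \<bar>1 / (1 + \<delta>) - 1\<bar>" by simp
    also have "1 / (1 + \<delta>) - 1 = - \<delta> / (1 + \<delta>)" using half by (simp add: field_simps)
    also have "\<bar>- \<delta> / (1 + \<delta>)\<bar> = \<bar>\<delta>\<bar> / (1 + \<delta>)" using half by simp
    also have "\<dots> \<le> \<bar>\<delta>\<bar> / (1 / 2)" using half by (intro divide_left_mono) auto
    also have "\<dots> \<le> 2 * K / real n" using \<delta> by simp
    finally show ?case .
  qed
  then show ?thesis using K by (intro exI[of _ "2 * K"]) auto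
qed

text \<open>
  Put \<open>u n = n powr \<alpha> * w n\<close>, which is \<open>1 + O(1/n)\<close>, so that \<open>w q / w p = (u q / u p) * (p / q) powr \<alpha>\<close>.
  If \<open>p\<close> is large and \<open>q\<close> is comparable to \<open>p\<close>, every factor is at most \<open>1 + O(1/(p+q))\<close>; the power
  exceeds \<open>1\<close> only for \<open>q = p - 1\<close>. If \<open>q > 2p\<close>, the power is below \<open>2 powr -\<alpha> < 1\<close>, which outweighs
  the errors in \<open>u\<close>. If \<open>p\<close> is small, \<open>w q\<close> falls below \<open>w p\<close> once \<open>q\<close> is large because \<open>w\<close> tends to \<open>0\<close>.
  The finitely many remaining pairs are absorbed in the constant.
\<close>

lemma weight_ratio_le:
  fixes w :: "nat \<Rightarrow> real"
  assumes \<alpha>: "\<alpha> > 0" and pos: "\<And>n. w n > 0" and L: "L > 0"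
    and ev: "\<forall>\<^sub>F n in sequentially. \<bar>real n powr \<alpha> * w n - 1\<bar> \<le> L / real n"
  shows "\<exists>C > 0. \<forall>p q. p \<le> q + 1 \<longrightarrow> w q \<le> w p * (1 + C / real (p + q + 1))"
proof -
  define u where "u n = real n powr \<alpha> * w n" for n
  have w_eq: "w n = u n * real n powr - \<alpha>" if "n > 0" for n
    using that by (simp add: u_def powr_minus field_simps)
  define s where "s = (2::real) powr \<alpha>"
  have s: "s > 1" using \<alpha> by (simp add: s_def)
  \<comment> \<open>A relative error of \<open>\<delta>\<close> in both \<open>u p\<close> and \<open>u q\<close> is still outweighed by the factor \<open>s\<close>.\<close>
  define \<delta> where "\<delta> = min (1 / 2) ((s - 1) / (s + 1))"
  have \<delta>: "0 < \<delta>" "\<delta> \<le> 1 / 2" "\<delta> \<le> (s - 1) / (s + 1)" using s unfolding \<delta>_def by (simp, linarith, linarith)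
  have \<delta>s: "1 + \<delta> \<le> s * (1 - \<delta>)" using \<delta>(3) s by (simp add: field_simps)
  have "\<forall>\<^sub>F n in sequentially. real n \<ge> max 1 (L / \<delta>)"
    by (rule filterlim_at_top[THEN iffD1, rule_format, OF filterlim_real_sequentially])
  then have "\<forall>\<^sub>F n in sequentially. n > 0 \<and> L / real n \<le> \<delta> \<and> \<bar>u n - 1\<bar> \<le> L / real n"
    using ev by eventually_elim (use \<delta> in \<open>auto simp: u_def field_simps\<close>)
  then obtain N where N: "\<And>n. n \<ge> N \<Longrightarrow> n > 0"  "\<And>n. n \<ge> N \<Longrightarrow> L / real n \<le> \<delta>"
      "\<And>n. n \<ge> N \<Longrightarrow> \<bar>u n - 1\<bar> \<le> L / real n"
    unfolding eventually_sequentially by blast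
  have u_pos: "u n > 0" if "n \<ge> N" for n using pos[of n] N(1)[OF that] by (simp add: u_def)
  have N0: "N > 0" using N(1) by blast
  \<comment> \<open>\<open>G\<close> collects the three exponents below, after \<open>1/q \<le> 4/z\<close> and \<open>1/p \<le> 5/z\<close> with \<open>z = p + q + 1\<close>.\<close>
  define G where "G = 14 * L + 4 * \<alpha>"
  have G: "G > 0" using L \<alpha> by (simp add: G_def)
  have comparable: "w q \<le> w p * (1 + G * exp G / real (p + q + 1))"
    if pq: "p > N" "p \<le> q + 1" "q \<le> 2 * p + 1" for p q
  proof -
    define z where "z = real (p + q + 1)"
    have pN: "p \<ge> N" and qN: "q \<ge> N" using pq by auto
    have p0: "p > 0" and q0: "q > 0" using N(1)[OF pN] N(1)[OF qN] by auto
    have z: "z \<ge> 1" "1 / real q \<le> 4 / z" "1 / real p \<le> 5 / z"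
      using pq p0 q0 by (auto simp: z_def field_simps)
    have "1 + 2 * (L / real p) \<ge> 1 / (1 - L / real p)"
    proof -
      define x where "x = L / real p"
      have x: "0 \<le> x" "x \<le> 1 / 2" using N(2)[OF pN] \<delta>(2) L unfolding x_def by (simp, linarith)
      then have "x * x \<le> x * (1 / 2)" by (intro mult_left_mono) auto
      then have "1 \<le> (1 + 2 * x) * (1 - x)" by (simp add: algebra_simps)
      then show ?thesis using x by (simp add: x_def[symmetric] field_simps)
    qed
    moreover have "1 / u p \<le> 1 / (1 - L / real p)"
      using N(2,3)[OF pN] u_pos[OF pN] \<delta> by (intro divide_left_mono) auto
    ultimately have up: "1 / u p \<le> exp (2 * (L / real p))"
      using exp_ge_add_one_self[of "2 * (L / real p)"] by linarith
    have uq: "u q \<le> exp (L / real q)"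
      using N(3)[OF qN] exp_ge_add_one_self[of "L / real q"] by linarith
    have "real p / real q \<le> 1 + 1 / real q" using pq q0 by (simp add: field_simps)
    also have "\<dots> \<le> exp (1 / real q)" by (rule exp_ge_add_one_self)
    finally have "(real p / real q) powr \<alpha> \<le> exp (1 / real q) powr \<alpha>"
      using \<alpha> by (intro powr_mono2) auto
    also have "\<dots> = exp (\<alpha> / real q)" by (simp add: powr_def)
    finally have pw: "(real p / real q) powr \<alpha> \<le> exp (\<alpha> / real q)" .
    have "w q / w p = u q * (1 / u p) * (real p / real q) powr \<alpha>"
      using p0 q0 by (simp add: w_eq powr_minus powr_divide field_simps)
    also have "\<dots> \<le> exp (L / real q) * exp (2 * (L / real p)) * exp (\<alpha> / real q)"
      using uq up pw u_pos[OF pN] u_pos[OF qN] by (intro mult_mono) auto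
    also have "\<dots> = exp ((L + \<alpha>) * (1 / real q) + 2 * L * (1 / real p))"
      by (simp add: exp_add[symmetric] add_divide_distrib algebra_simps)
    also have "\<dots> \<le> exp ((L + \<alpha>) * (4 / z) + 2 * L * (5 / z))"
      unfolding exp_le_cancel_iff using L \<alpha> z by (intro add_mono mult_left_mono) auto
    also have "(L + \<alpha>) * (4 / z) + 2 * L * (5 / z) = G / z"
      by (simp add: G_def add_divide_distrib algebra_simps)
    also have "exp (G / z) \<le> 1 + G / z * exp (G / z)" by (rule exp_minus_one_le)
    also have "\<dots> \<le> 1 + G / z * exp G"
      using G z by (intro add_left_mono mult_left_mono) (auto simp: field_simps)
    finally show ?thesis using pos[of p] by (simp add: z_def field_simps)
  qed
  have far_le: "w q \<le> w p" if pq: "p \<ge> N" "q > 2 * p" for p q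
  proof -
    have qN: "q \<ge> N" using pq by auto
    have p0: "p > 0" and q0: "q > 0" using N(1)[OF pq(1)] N(1)[OF qN] by auto
    have "s * real p powr \<alpha> = (2 * real p) powr \<alpha>" by (simp add: s_def powr_mult)
    also have "\<dots> \<le> real q powr \<alpha>" using pq \<alpha> by (intro powr_mono2) auto
    finally have sp: "s * real p powr \<alpha> \<le> real q powr \<alpha>" .
    have "real q powr \<alpha> * w q \<le> 1 + \<delta>" using N(2,3)[OF qN] by (simp add: u_def)
    also have "\<dots> \<le> s * (1 - \<delta>)" by (rule \<delta>s)
    also have "\<dots> \<le> s * (real p powr \<alpha> * w p)"
      using N(2,3)[OF pq(1)] s by (intro mult_left_mono) (auto simp: u_def)
    also have "\<dots> \<le> real q powr \<alpha> * w p"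
      using sp pos[of p] by (simp add: mult.assoc[symmetric] mult_right_mono)
    finally show ?thesis using q0 by simp
  qed
  define \<mu> where "\<mu> = Min (w ` {..N})"
  have \<mu>: "\<mu> > 0" "\<And>p. p \<le> N \<Longrightarrow> \<mu> \<le> w p" using pos by (auto simp: \<mu>_def)
  have "(\<lambda>n. 2 * real n powr - \<alpha>) \<longlonglongrightarrow> 2 * 0"
    using \<alpha> by (intro tendsto_mult tendsto_const tendsto_neg_powr filterlim_real_sequentially) auto
  then have "\<forall>\<^sub>F n in sequentially. 2 * real n powr - \<alpha> < \<mu>"
    using \<mu> by (intro order_tendstoD) auto
  then obtain Q0 where Q0: "\<And>n. n \<ge> Q0 \<Longrightarrow> 2 * real n powr - \<alpha> < \<mu>"
    unfolding eventually_sequentially by blast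
  define Q where "Q = max N Q0"
  have small_le: "w q \<le> w p" if "p \<le> N" "q \<ge> Q" for p q
  proof -
    have qN: "q \<ge> N" using that by (auto simp: Q_def)
    have "w q = u q * real q powr - \<alpha>" by (rule w_eq[OF N(1)[OF qN]])
    also have "\<dots> \<le> 2 * real q powr - \<alpha>"
      using N(2,3)[OF qN] \<delta> by (intro mult_right_mono) auto
    also have "\<dots> < \<mu>" using that by (intro Q0) (auto simp: Q_def)
    finally show ?thesis using \<mu>(2)[OF that(1)] by simp
  qed
  define F where "F = (\<lambda>(p, q). w q / w p * real (p + q + 1)) ` ({..N} \<times> {..Q})"
  define C where "C = max (G * exp G) (Max F)"
  have C: "C > 0" using G by (simp add: C_def less_max_iff_disj)
  have "w q \<le> w p * (1 + C / real (p + q + 1))" if "p \<le> q + 1" for p q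
  proof -
    have *: ?thesis if "w q \<le> w p * (1 + x)" "x \<le> C / real (p + q + 1)" for x
      using that pos[of p] by (smt (verit) mult_left_mono)
    consider (comp) "p > N" "q \<le> 2 * p + 1" | (far) "p > N" "q > 2 * p + 1"
      | (small) "p \<le> N" "q \<ge> Q" | (fin) "p \<le> N" "q < Q" by linarith
    then show ?thesis
    proof cases
      case comp
      show ?thesis by (rule *[OF comparable[OF comp(1) that comp(2)]]) (auto simp: C_def intro!: divide_right_mono)
    next
      case far
      then show ?thesis using far_le[of p q] C
        by (intro *[of 0]) auto
    next
      case small
      then show ?thesis using small_le[of p q] C
        by (intro *[of 0]) auto
    next
      case fin
      then have "w q / w p * real (p + q + 1) \<in> F" by (force simp: F_def)
      then have "w q / w p * real (p + q + 1) \<le> C"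
        by (simp add: C_def F_def le_max_iff_disj)
      then have "w q / w p \<le> C / real (p + q + 1)"
        by (subst pos_le_divide_eq) auto
      then show ?thesis using pos[of p] by (intro *[of "w q / w p"]) (auto simp: field_simps)
    qed
  qed
  then show ?thesis using C by blast
qed

text \<open>
  The indices used by the three urn types at \<open>(i, j)\<close> are \<open>2i\<close> or \<open>2i + 1\<close> for blue and \<open>2j\<close> or \<open>2j + 1\<close>
  for red. When \<open>i \<le> j\<close>, the blue index can exceed the red one only by \<open>1\<close>, which is the slack
  \<open>p \<le> q + 1\<close> in the hypothesis.
\<close>

lemma urn_drift_outward_le:
  fixes w :: "nat \<Rightarrow> real"
  assumes ratio: "\<And>p q. p \<le> q + 1 \<Longrightarrow> w q \<le> w p * (1 + C / real (p + q + 1))"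
    and C: "C \<ge> 0" and pos: "\<And>n. w n > 0"
  shows "i \<le> j \<Longrightarrow> red_weight t w j \<le> blue_weight t w i * (1 + C / real (i + j + 1))"
    and "j \<le> i \<Longrightarrow> blue_weight t w i \<le> red_weight t w j * (1 + C / real (i + j + 1))"
proof -
  have *: "w q \<le> w p * (1 + C / real (i + j + 1))" if "p \<le> q + 1" "i + j \<le> p + q" for p q
  proof -
    have "C / real (p + q + 1) \<le> C / real (i + j + 1)"
      using C that(2) by (intro divide_left_mono) auto
    then have "w p * (1 + C / real (p + q + 1)) \<le> w p * (1 + C / real (i + j + 1))"
      using pos[of p] by (intro mult_left_mono) auto
    with ratio[OF that(1)] show ?thesis by linarith
  qed
  show "i \<le> j \<Longrightarrow> red_weight t w j \<le> blue_weight t w i * (1 + C / real (i + j + 1))"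
    by (cases t) (simp only: blue_weight.simps red_weight.simps; rule *; simp)+
  show "j \<le> i \<Longrightarrow> blue_weight t w i \<le> red_weight t w j * (1 + C / real (i + j + 1))"
    by (cases t) (simp only: blue_weight.simps red_weight.simps; rule *; simp)+
qed

section \<open>Paths of the urn process\<close>

definition draws_single_balls :: "(nat \<Rightarrow> 'a \<Rightarrow> nat \<times> nat) \<Rightarrow> 'a \<Rightarrow> bool" where
  "draws_single_balls X \<omega> \<longleftrightarrow> X 0 \<omega> = (0, 0) \<and>
     (\<forall>n. X (Suc n) \<omega> = (Suc (fst (X n \<omega>)), snd (X n \<omega>)) \<or>
          X (Suc n) \<omega> = (fst (X n \<omega>), Suc (snd (X n \<omega>))))"

lemma urn_process_draws_single_balls:
  assumes urn: "urn_process M b r X"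
  shows "AE \<omega> in M. draws_single_balls X \<omega>"
proof -
  have mc: "markov_chain_from M (urn_transition b r) (0, 0) X"
    using urn by (simp add: urn_process_def)
  have "y = (Suc (fst x), snd x) \<or> y = (fst x, Suc (snd x))"
    if "urn_transition b r x y \<noteq> 0" for x y
    using that by (cases x) (auto simp: urn_transition_def split: if_splits)
  note succ = this
  have "AE \<omega> in M. X 0 \<omega> = (0, 0)" using mc by (simp add: markov_chain_from_def)
  then show ?thesis using markov_chain_AE_transition[OF mc]
    by eventually_elim (use succ in \<open>simp add: draws_single_balls_def\<close>)
qed

lemma draws_single_balls_fst:
  assumes "draws_single_balls X \<omega>"
  shows "fst (X (Suc n) \<omega>) = fst (X n \<omega>) \<or> fst (X (Suc n) \<omega>) = Suc (fst (X n \<omega>))"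
proof -
  have "X (Suc n) \<omega> = (Suc (fst (X n \<omega>)), snd (X n \<omega>)) \<or>
        X (Suc n) \<omega> = (fst (X n \<omega>), Suc (snd (X n \<omega>)))"
    using assms by (simp add: draws_single_balls_def)
  then show ?thesis by auto
qed

lemma draws_single_balls_total:
  assumes "draws_single_balls X \<omega>"
  shows "fst (X n \<omega>) + snd (X n \<omega>) = n"
proof (induction n)
  case 0
  then show ?case using assms by (simp add: draws_single_balls_def)
next
  case (Suc n)
  have "X (Suc n) \<omega> = (Suc (fst (X n \<omega>)), snd (X n \<omega>)) \<or>
        X (Suc n) \<omega> = (fst (X n \<omega>), Suc (snd (X n \<omega>)))"
    using assms by (auto simp: draws_single_balls_def)
  then show ?case using Suc by auto
qed

lemma urn_process_discrepancy_sets: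
  assumes "urn_process M b r X"
  shows "{\<omega> \<in> space M. \<bar>discrepancy X n \<omega>\<bar> \<ge> int m} \<in> sets M"
proof -
  have X: "X n \<in> measurable M (count_space UNIV)"
    using assms by (simp add: urn_process_def markov_chain_from_def)
  have "X n -` {y. \<bar>int (snd y) - int (fst y)\<bar> \<ge> int m} \<inter> space M \<in> sets M"
    by (rule measurable_sets[OF X]) simp
  also have "X n -` {y. \<bar>int (snd y) - int (fst y)\<bar> \<ge> int m} \<inter> space M
      = {\<omega> \<in> space M. \<bar>discrepancy X n \<omega>\<bar> \<ge> int m}"
    by (auto simp: discrepancy_def)
  finally show ?thesis .
qed

lemma nn_integral_urn_transition:
  assumes "b i > 0" "r j > 0"
  shows "(\<integral>\<^sup>+y. ennreal (urn_transition b r (i, j) y) * f y \<partial>count_space UNIV)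
       = ennreal (b i / (b i + r j)) * f (Suc i, j) + ennreal (r j / (b i + r j)) * f (i, Suc j)"
  by (subst nn_integral_count_space'[where A = "{(Suc i, j), (i, Suc j)}"])
     (auto simp: urn_transition_def)

section \<open>Exponential moments and tails of the discrepancy\<close>

lemma sinh_le_mult_cosh: "sinh x \<le> x * cosh x" if "x \<ge> 0" for x :: real
proof -
  have "(\<lambda>x. x * cosh x - sinh x) 0 \<le> (\<lambda>x. x * cosh x - sinh x) x"
    by (rule DERIV_nonneg_imp_nondecreasing[OF that])
       (auto intro!: derivative_eq_intros exI)
  then show ?thesis by simp
qed

text \<open>
  The derivative of \<open>x\<^sup>2/2 - ln (cosh x)\<close> is \<open>x - tanh x\<close>, which the previous lemma shows to be
  nonnegative.
\<close>

lemma cosh_le_exp_half_square: "cosh x \<le> exp (x\<^sup>2 / 2)" if "x \<ge> 0" for x :: real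
proof -
  have "(\<lambda>x. x\<^sup>2 / 2 - ln (cosh x)) 0 \<le> (\<lambda>x. x\<^sup>2 / 2 - ln (cosh x)) x"
  proof (rule DERIV_nonneg_imp_nondecreasing[OF that])
    fix y :: real assume "0 \<le> y"
    then have "0 \<le> y - sinh y / cosh y" using sinh_le_mult_cosh[of y] by (simp add: field_simps)
    moreover have "((\<lambda>x. x\<^sup>2 / 2 - ln (cosh x)) has_real_derivative (y - sinh y / cosh y)) (at y)"
      by (auto intro!: derivative_eq_intros)
    ultimately show "\<exists>d. ((\<lambda>x. x\<^sup>2 / 2 - ln (cosh x)) has_real_derivative d) (at y) \<and> 0 \<le> d" by blast
  qed
  then have "ln (cosh x) \<le> x\<^sup>2 / 2" by simp
  then show ?thesis by (metis cosh_real_pos exp_le_cancel_iff exp_ln)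
qed

text \<open>
  The harmonic sum is logarithmic; this weaker bound has the form needed in the Gaussian exponent.
\<close>

lemma sum_inverse_le_sqrt: "(\<Sum>k<n. 1 / real (Suc k)) \<le> 2 * sqrt (real n)"
proof (induction n)
  case (Suc n)
  define a b where "a = sqrt (real n)" and "b = sqrt (real (Suc n))"
  have ab: "0 \<le> a" "a \<le> b" "b > 0" "b\<^sup>2 = a\<^sup>2 + 1" by (auto simp: a_def b_def)
  have "1 = (b - a) * (b + a)" using ab(4) by (simp add: algebra_simps power2_eq_square)
  also have "\<dots> \<le> (b - a) * (2 * b)" using ab by (intro mult_left_mono) auto
  finally have "1 \<le> 2 * (b - a) * b" by (simp add: algebra_simps)
  then have "1 / b \<le> 2 * (b - a)" using ab by (simp add: field_simps)
  moreover have "b \<ge> 1" by (simp add: b_def)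
  then have "1 / b\<^sup>2 \<le> 1 / b" using self_le_power[of b 2] by (intro divide_left_mono) auto
  ultimately have "1 / b\<^sup>2 \<le> 2 * b - 2 * a" by (simp add: algebra_simps)
  moreover have "b\<^sup>2 = real (Suc n)" by (simp add: b_def)
  ultimately show ?case using Suc by (simp add: a_def b_def)
qed simp

text \<open>
  Here \<open>p\<close> is the probability of a step up. The addition formulas give
  \<open>cosh l * cosh (l*d) + (2p-1) * sinh l * sinh (l*d)\<close>. The second summand is positive only if the
  mean step \<open>2p - 1\<close> points away from \<open>0\<close>, and then it is at most \<open>c * sinh l * cosh (l*d)\<close>. A bias
  towards \<open>0\<close>, however strong, only lowers the left-hand side.
\<close>

lemma cosh_step_le:
  fixes p c d l :: real
  assumes l: "l \<ge> 0" and c: "c \<ge> 0"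
    and up: "d \<ge> 0 \<Longrightarrow> 2 * p - 1 \<le> c" and down: "d \<le> 0 \<Longrightarrow> 1 - 2 * p \<le> c"
  shows "p * cosh (l * (d + 1)) + (1 - p) * cosh (l * (d - 1)) \<le> exp (l\<^sup>2 / 2 + c * l) * cosh (l * d)"
proof -
  have "(2 * p - 1) * sinh (l * d) \<le> c * \<bar>sinh (l * d)\<bar>"
  proof (cases "d \<ge> 0")
    case True
    then show ?thesis using up l by (simp add: mult_right_mono)
  next
    case False
    then have "l * d \<le> 0" using l by (simp add: mult_nonneg_nonpos)
    then have "\<bar>sinh (l * d)\<bar> = - sinh (l * d)" "sinh (l * d) \<le> 0" by (auto simp: abs_if not_less)
    moreover have "(1 - 2 * p) * (- sinh (l * d)) \<le> c * (- sinh (l * d))"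
      using calculation False down by (intro mult_right_mono) auto
    ultimately show ?thesis by (simp add: algebra_simps)
  qed
  also have "\<dots> \<le> c * cosh (l * d)"
  proof -
    have "\<bar>sinh (l * d)\<bar> = sinh \<bar>l * d\<bar>" by (simp add: sinh_real_abs)
    also have "\<dots> \<le> cosh \<bar>l * d\<bar>" by (rule sinh_le_cosh_real)
    finally show ?thesis using c by (intro mult_left_mono) auto
  qed
  finally have bias: "(2 * p - 1) * sinh (l * d) \<le> c * cosh (l * d)" .
  have "p * cosh (l * (d + 1)) + (1 - p) * cosh (l * (d - 1))
      = cosh l * cosh (l * d) + sinh l * ((2 * p - 1) * sinh (l * d))"
    by (simp add: distrib_left right_diff_distrib cosh_add cosh_diff algebra_simps)
  also have "\<dots> \<le> cosh l * cosh (l * d) + sinh l * (c * cosh (l * d))"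
    using bias l by (intro add_left_mono mult_left_mono) auto
  also have "\<dots> \<le> cosh l * cosh (l * d) + (l * cosh l) * (c * cosh (l * d))"
    using sinh_le_mult_cosh[OF l] c by (intro add_left_mono mult_right_mono) auto
  also have "\<dots> = cosh l * (1 + c * l) * cosh (l * d)" by (simp add: algebra_simps)
  also have "\<dots> \<le> exp (l\<^sup>2 / 2) * exp (c * l) * cosh (l * d)"
    using cosh_le_exp_half_square[OF l] exp_ge_add_one_self[of "c * l"] c l
    by (intro mult_right_mono mult_mono) auto
  finally show ?thesis by (simp add: exp_add)
qed

lemma urn_nn_integral_cosh_le:
  fixes b r :: "nat \<Rightarrow> real" and l :: real
  assumes urn: "urn_process M b r X"
    and pos: "\<And>i. b i > 0" "\<And>j. r j > 0"
    and C: "C \<ge> 0" and l: "l \<ge> 0"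
    and red: "\<And>i j. i \<le> j \<Longrightarrow> r j \<le> b i * (1 + C / real (i + j + 1))"
    and blue: "\<And>i j. j \<le> i \<Longrightarrow> b i \<le> r j * (1 + C / real (i + j + 1))"
  shows "(\<integral>\<^sup>+\<omega>. ennreal (cosh (l * discrepancy X n \<omega>)) \<partial>M)
       \<le> ennreal (exp (real n * l\<^sup>2 / 2 + C * l * (\<Sum>k<n. 1 / real (Suc k))))"
proof (induction n)
  case 0
  have mc: "markov_chain_from M (urn_transition b r) (0, 0) X"
    using urn by (simp add: urn_process_def)
  interpret prob_space M using mc by (simp add: markov_chain_from_def)
  have "(\<integral>\<^sup>+\<omega>. ennreal (cosh (l * discrepancy X 0 \<omega>)) \<partial>M) = (\<integral>\<^sup>+\<omega>. 1 \<partial>M)"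
    using urn_process_draws_single_balls[OF urn]
    by (intro nn_integral_cong_AE, eventually_elim)
       (simp add: discrepancy_def draws_single_balls_def)
  then show ?case by (simp add: emeasure_space_1)
next
  case (Suc n)
  have mc: "markov_chain_from M (urn_transition b r) (0, 0) X"
    using urn by (simp add: urn_process_def)
  have X[measurable]: "X k \<in> measurable M (count_space UNIV)" for k
    using mc by (simp add: markov_chain_from_def)
  define V where "V y = cosh (l * (real (snd y) - real (fst y)))" for y :: "nat \<times> nat"
  define q where "q = exp (l\<^sup>2 / 2 + C / real (Suc n) * l)"
  have V: "cosh (l * discrepancy X k \<omega>) = V (X k \<omega>)" for k \<omega>
    by (simp add: V_def discrepancy_def)
  have step: "(\<integral>\<^sup>+y. ennreal (urn_transition b r (i, j) y) * ennreal (V y) \<partial>count_space UNIV)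
      \<le> ennreal q * ennreal (V (i, j))" if n: "i + j = n" for i j
  proof -
    define p where "p = r j / (b i + r j)"
    have s: "b i + r j > 0" using pos[of i] pos(2)[of j] by simp
    have p: "0 \<le> p" "0 \<le> 1 - p" "b i / (b i + r j) = 1 - p"
      using s pos(1)[of i] pos(2)[of j] by (auto simp: p_def field_simps)
    have c: "0 \<le> C / real (Suc n)" using C by simp
    \<comment> \<open>Both colours are treated at once: \<open>y\<close> is the weight of the colour that is ahead.\<close>
    have bias: "(y - x) / (x + y) \<le> C / real (Suc n)"
      if "y \<le> x * (1 + C / real (i + j + 1))" "x > 0" "y > 0" for x y :: real
    proof -
      have "y - x \<le> C / real (Suc n) * x" using that n by (simp add: algebra_simps)
      also have "\<dots> \<le> C / real (Suc n) * (x + y)" using c that by (intro mult_left_mono) auto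
      finally show ?thesis using that by (subst pos_divide_le_eq) auto
    qed
    have up: "2 * p - 1 \<le> C / real (Suc n)" if "i \<le> j"
      using bias[OF red[OF that] pos] s by (simp add: p_def field_simps)
    have down: "1 - 2 * p \<le> C / real (Suc n)" if "j \<le> i"
      using bias[of "b i" "r j"] blue[OF that] pos s by (simp add: p_def field_simps)
    have "p * V (i, Suc j) + (1 - p) * V (Suc i, j) \<le> q * V (i, j)"
      using cosh_step_le[of l "C / real (Suc n)" "real j - real i" p] l c up down
      by (simp add: V_def q_def algebra_simps)
    moreover have "(\<integral>\<^sup>+y. ennreal (urn_transition b r (i, j) y) * ennreal (V y) \<partial>count_space UNIV)
       = ennreal (p * V (i, Suc j) + (1 - p) * V (Suc i, j))"
      using p pos by (simp add: nn_integral_urn_transition p_def[symmetric] ennreal_mult[symmetric]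
        ennreal_plus[symmetric] V_def add.commute del: ennreal_plus)
    ultimately show ?thesis
      by (simp add: ennreal_mult[symmetric] V_def q_def ennreal_leI)
  qed
  have "(\<integral>\<^sup>+\<omega>. ennreal (cosh (l * discrepancy X (Suc n) \<omega>)) \<partial>M)
      = (\<integral>\<^sup>+\<omega>. (\<integral>\<^sup>+y. ennreal (urn_transition b r (X n \<omega>) y) * ennreal (V y) \<partial>count_space UNIV) \<partial>M)"
    unfolding V by (rule markov_chain_nn_integral_step[OF mc])
  also have "\<dots> \<le> (\<integral>\<^sup>+\<omega>. ennreal q * ennreal (V (X n \<omega>)) \<partial>M)"
  proof (intro nn_integral_mono_AE)
    show "AE \<omega> in M. (\<integral>\<^sup>+y. ennreal (urn_transition b r (X n \<omega>) y) * ennreal (V y) \<partial>count_space UNIV)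
        \<le> ennreal q * ennreal (V (X n \<omega>))"
      using urn_process_draws_single_balls[OF urn]
    proof eventually_elim
      case (elim \<omega>)
      then have "fst (X n \<omega>) + snd (X n \<omega>) = n" by (rule draws_single_balls_total)
      from step[OF this] show ?case by simp
    qed
  qed
  also have "\<dots> = ennreal q * (\<integral>\<^sup>+\<omega>. ennreal (V (X n \<omega>)) \<partial>M)"
    by (intro nn_integral_cmult measurable_compose[OF X]) simp
  also have "\<dots> \<le> ennreal q * ennreal (exp (real n * l\<^sup>2 / 2 + C * l * (\<Sum>k<n. 1 / real (Suc k))))"
    using Suc by (intro mult_left_mono) (auto simp: V)
  also have "\<dots> = ennreal (exp (real (Suc n) * l\<^sup>2 / 2 + C * l * (\<Sum>k<Suc n. 1 / real (Suc k))))"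
  proof -
    define S z where "S = (\<Sum>k<n. 1 / real (Suc k))" and "z = 1 / real (Suc n)"
    have "real (Suc n) * l\<^sup>2 / 2 + C * l * (S + z) = (l\<^sup>2 / 2 + C * z * l) + (real n * l\<^sup>2 / 2 + C * l * S)"
      unfolding of_nat_Suc by (simp add: algebra_simps add_divide_distrib)
    moreover have "C / real (Suc n) = C * z" by (simp add: z_def)
    moreover have "(\<Sum>k<Suc n. 1 / real (Suc k)) = S + z" by (simp add: S_def z_def)
    ultimately show ?thesis
      unfolding q_def S_def[symmetric] by (simp only: exp_add ennreal_mult exp_ge_zero mult_nonneg_nonneg)
  qed
  finally show ?case .
qed

text \<open>
  Markov's inequality for \<open>cosh (l * D)\<close>, which is at least \<open>exp (l*m) / 2\<close> on the event. The choice
  \<open>l = m/N\<close> minimises \<open>N * l\<^sup>2 / 2 - l * m\<close>; the bias adds at most \<open>2*C*x\<close> with \<open>x = m / sqrt N\<close>, and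
  \<open>2*C*x \<le> 4*C\<^sup>2 + x\<^sup>2/4\<close> keeps half of the quadratic gain.
\<close>

lemma urn_discrepancy_tail:
  fixes b r :: "nat \<Rightarrow> real"
  assumes urn: "urn_process M b r X"
    and pos: "\<And>i. b i > 0" "\<And>j. r j > 0"
    and C: "C \<ge> 0"
    and red: "\<And>i j. i \<le> j \<Longrightarrow> r j \<le> b i * (1 + C / real (i + j + 1))"
    and blue: "\<And>i j. j \<le> i \<Longrightarrow> b i \<le> r j * (1 + C / real (i + j + 1))"
    and N: "n \<le> N" "m \<le> N" "N > 0"
  shows "\<P>(\<omega> in M. \<bar>discrepancy X n \<omega>\<bar> \<ge> int m) \<le> 2 * exp (4 * C\<^sup>2) * exp (- ((real m)\<^sup>2 / (4 * real N)))"
proof -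
  have mc: "markov_chain_from M (urn_transition b r) (0, 0) X"
    using urn by (simp add: urn_process_def)
  interpret prob_space M using mc by (simp add: markov_chain_from_def)
  define l where "l = real m / real N"
  define H where "H = (\<Sum>k<n. 1 / real (Suc k))"
  define A where "A = {\<omega> \<in> space M. \<bar>discrepancy X n \<omega>\<bar> \<ge> int m}"
  have l: "l \<ge> 0" by (simp add: l_def)
  have A[measurable]: "A \<in> sets M" unfolding A_def by (rule urn_process_discrepancy_sets[OF urn])
  have "ennreal (exp (l * m) / 2) * emeasure M A = (\<integral>\<^sup>+\<omega>. ennreal (exp (l * m) / 2) * indicator A \<omega> \<partial>M)"
    by (simp add: nn_integral_cmult_indicator)
  also have "\<dots> \<le> (\<integral>\<^sup>+\<omega>. ennreal (cosh (l * discrepancy X n \<omega>)) \<partial>M)"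
  proof (intro nn_integral_mono)
    fix \<omega>
    show "ennreal (exp (l * m) / 2) * indicator A \<omega> \<le> ennreal (cosh (l * discrepancy X n \<omega>))"
    proof (cases "\<omega> \<in> A")
      case True
      then have "real m \<le> \<bar>real_of_int (discrepancy X n \<omega>)\<bar>" by (simp add: A_def) linarith
      then have "l * m \<le> \<bar>l * discrepancy X n \<omega>\<bar>" using l by (simp add: abs_mult mult_left_mono)
      then have "exp (l * m) / 2 \<le> exp \<bar>l * discrepancy X n \<omega>\<bar> / 2" by simp
      also have "\<dots> \<le> cosh \<bar>l * discrepancy X n \<omega>\<bar>" by (simp add: cosh_field_def)
      finally show ?thesis using True by (simp add: ennreal_leI)
    qed simp
  qed
  also have "\<dots> \<le> ennreal (exp (real n * l\<^sup>2 / 2 + C * l * H))"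
    unfolding H_def by (rule urn_nn_integral_cosh_le[OF urn pos C l red blue])
  finally have "exp (l * m) / 2 * measure M A \<le> exp (real n * l\<^sup>2 / 2 + C * l * H)"
    by (simp add: emeasure_eq_measure ennreal_mult[symmetric])
  then have "measure M A \<le> 2 * (exp (real n * l\<^sup>2 / 2 + C * l * H) / exp (l * m))"
    by (simp add: field_simps)
  also have "\<dots> = 2 * exp (real n * l\<^sup>2 / 2 + C * l * H - l * m)"
    by (simp add: exp_diff)
  finally have bound: "measure M A \<le> 2 * exp (real n * l\<^sup>2 / 2 + C * l * H - l * m)" .
  have "real n * l\<^sup>2 / 2 + C * l * H - l * m \<le> 4 * C\<^sup>2 - (real m)\<^sup>2 / (4 * real N)"
  proof -
    define x where "x = real m / sqrt (real N)"
    have lm: "l * m = x\<^sup>2" "real N * l\<^sup>2 = x\<^sup>2" and lx: "l * sqrt (real N) = x"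
      using N by (simp_all add: l_def x_def power_divide power2_eq_square field_simps)
    have x2: "(real m)\<^sup>2 / (4 * real N) = x\<^sup>2 / 4"
      by (simp add: x_def power_divide)
    have "real n * l\<^sup>2 \<le> real N * l\<^sup>2" using N by (intro mult_right_mono) auto
    moreover have "H \<le> 2 * sqrt (real N)"
    proof -
      have "H \<le> 2 * sqrt (real n)" unfolding H_def by (rule sum_inverse_le_sqrt)
      also have "\<dots> \<le> 2 * sqrt (real N)" using N by simp
      finally show ?thesis .
    qed
    then have "C * l * H \<le> C * l * (2 * sqrt (real N))" using C l by (intro mult_left_mono) auto
    moreover have "C * l * (2 * sqrt (real N)) = 2 * C * x" using lx by (simp add: algebra_simps)
    ultimately have "real n * l\<^sup>2 / 2 + C * l * H - l * m \<le> 2 * C * x - x\<^sup>2 / 2"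
      using lm by linarith
    also have "\<dots> \<le> 4 * C\<^sup>2 - x\<^sup>2 / 4"
      using zero_le_power2[of "x / 2 - 2 * C"] by (simp add: power2_eq_square algebra_simps)
    finally show ?thesis by (simp add: x2)
  qed
  then have "exp (real n * l\<^sup>2 / 2 + C * l * H - l * m)
      \<le> exp (4 * C\<^sup>2) * exp (- ((real m)\<^sup>2 / (4 * real N)))"
    by (simp flip: exp_add)
  with bound show ?thesis by (simp add: A_def)
qed

section \<open>The time of a blue draw\<close>

lemma blue_time_greater_iff:
  assumes path: "draws_single_balls X \<omega>"
  shows "enat N < blue_time X k \<omega> \<longleftrightarrow> fst (X N \<omega>) < k"
proof (induction k arbitrary: N)
  case 0
  then show ?case by (simp add: zero_enat_def)
next
  case (Suc k)
  have X0: "X 0 \<omega> = (0, 0)" using path by (simp add: draws_single_balls_def)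
  have step: "fst (X (Suc n) \<omega>) = fst (X n \<omega>) \<or> fst (X (Suc n) \<omega>) = Suc (fst (X n \<omega>))" for n
    by (rule draws_single_balls_fst[OF path])
  define \<beta> where "\<beta> n = fst (X n \<omega>)" for n
  have mono: "\<beta> m \<le> \<beta> n" if "m \<le> n" for m n
  proof (rule lift_Suc_mono_le[OF _ that])
    show "\<beta> n \<le> \<beta> (Suc n)" for n using step[of n] by (auto simp: \<beta>_def)
  qed
  have IH: "enat n < blue_time X k \<omega> \<longleftrightarrow> \<beta> n < k" for n
    using Suc.IH by (simp add: \<beta>_def)
  define S where "S = {enat n |n. blue_time X k \<omega> < enat n \<and> \<beta> n = \<beta> (n - 1) + 1}"
  \<comment> \<open>By the induction hypothesis, a blue draw comes after the \<open>k\<close>-th one iff at least \<open>k\<close> blue balls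
    preceded it. So such a draw has occurred by time \<open>N\<close> iff the count has reached \<open>k + 1\<close>.\<close>
  have "(\<exists>n\<le>N. blue_time X k \<omega> < enat n \<and> \<beta> n = \<beta> (n - 1) + 1) \<longleftrightarrow> \<beta> N \<ge> Suc k"
  proof
    assume "\<exists>n\<le>N. blue_time X k \<omega> < enat n \<and> \<beta> n = \<beta> (n - 1) + 1"
    then obtain n where n: "n \<le> N" "blue_time X k \<omega> < enat n" "\<beta> n = \<beta> (n - 1) + 1" by blast
    then obtain n' where [simp]: "n = Suc n'" by (cases n) auto
    have "blue_time X k \<omega> \<le> enat n'"
      using n(2) by (cases "blue_time X k \<omega>") auto
    then have "\<beta> n' \<ge> k" using IH[of n'] by (metis not_less)
    then show "\<beta> N \<ge> Suc k" using mono[OF n(1)] n(3) by simp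
  next
    assume "\<beta> N \<ge> Suc k"
    then show "\<exists>n\<le>N. blue_time X k \<omega> < enat n \<and> \<beta> n = \<beta> (n - 1) + 1"
    proof (induction N)
      case 0
      then show ?case using X0 by (simp add: \<beta>_def)
    next
      case (Suc N)
      show ?case
      proof (cases "\<beta> N \<ge> Suc k")
        case True
        then show ?thesis using Suc.IH le_Suc_eq by blast
      next
        case False
        then have "\<beta> N = k" "\<beta> (Suc N) = Suc k" using step[of N] Suc.prems by (auto simp: \<beta>_def)
        moreover have "blue_time X k \<omega> \<le> enat N" using IH[of N] \<open>\<beta> N = k\<close> by (metis not_less order_refl)
        ultimately show ?thesis
          by (intro exI[of _ "Suc N"]) (auto intro: order.strict_trans1)
      qed
    qed
  qed
  moreover have "enat N < Inf S \<longleftrightarrow> \<not> (\<exists>n\<le>N. enat n \<in> S)"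
  proof
    assume "enat N < Inf S"
    then show "\<not> (\<exists>n\<le>N. enat n \<in> S)"
      by (metis Inf_lower enat_ord_simps(1) leD order.trans)
  next
    assume *: "\<not> (\<exists>n\<le>N. enat n \<in> S)"
    have "enat (Suc N) \<le> Inf S"
    proof (rule Inf_greatest)
      fix x assume "x \<in> S"
      then obtain n where "x = enat n" by (auto simp: S_def)
      then show "enat (Suc N) \<le> x" using * \<open>x \<in> S\<close> by (metis enat_ord_simps(1) not_less_eq_eq)
    qed
    then show "enat N < Inf S" by (metis enat_ord_simps(2) lessI order.strict_trans2)
  qed
  moreover have "enat n \<in> S \<longleftrightarrow> blue_time X k \<omega> < enat n \<and> \<beta> n = \<beta> (n - 1) + 1" for n
    by (auto simp: S_def)
  moreover have "blue_time X (Suc k) \<omega> = Inf S" by (simp add: S_def \<beta>_def)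
  ultimately show ?case by (simp add: not_le \<beta>_def)
qed

text \<open>
  With \<open>n\<close> blue balls at time \<open>t\<close> the discrepancy is \<open>t - 2n\<close>. So it is at least \<open>m\<close> only if the
  \<open>n\<close>-th blue draw is missing from the first \<open>2n + m - 1\<close> draws, which also covers an infinite time,
  and at most \<open>-m\<close> only if it is among the first \<open>2n - m\<close>; in that case \<open>m \<le> 2n\<close>, so the
  subtraction does not truncate.
\<close>

lemma discrepancy_at_blue_time_imp:
  assumes path: "draws_single_balls X \<omega>"
    and nm: "n \<ge> 1" "m \<ge> 1"
    and D: "discrepancy_at_ge X (blue_time X n) m \<omega>"
  shows "\<bar>discrepancy X (2 * n + m - 1) \<omega>\<bar> \<ge> int m \<or> \<bar>discrepancy X (2 * n - m) \<omega>\<bar> \<ge> int m"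
proof -
  define \<beta> where "\<beta> k = fst (X k \<omega>)" for k
  have fst_step: "fst (X (Suc k) \<omega>) = fst (X k \<omega>) \<or> fst (X (Suc k) \<omega>) = Suc (fst (X k \<omega>))" for k
    by (rule draws_single_balls_fst[OF path])
  have less: "enat k < blue_time X n \<omega> \<longleftrightarrow> \<beta> k < n" for k
    unfolding \<beta>_def by (rule blue_time_greater_iff[OF path])
  have disc: "discrepancy X k \<omega> = int k - 2 * int (\<beta> k)" for k
    using draws_single_balls_total[OF path, of k] by (simp add: discrepancy_def \<beta>_def)
  have late: ?thesis if "enat (2 * n + m - 1) < blue_time X n \<omega>"
    using less[of "2 * n + m - 1"] that nm by (auto simp: disc)
  show ?thesis
  proof (cases "blue_time X n \<omega>")
    case infinity
    then show ?thesis by (intro late) simp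
  next
    case (enat t)
    have "\<beta> t = n"
    proof -
      have "\<beta> t \<ge> n" using less[of t] enat by simp
      moreover have "\<beta> t \<le> n"
      proof (cases t)
        case 0
        then show ?thesis using path by (simp add: \<beta>_def draws_single_balls_def)
      next
        case (Suc t')
        then have "\<beta> t' < n" using less[of t'] enat by simp
        then show ?thesis using fst_step[of t'] Suc by (auto simp: \<beta>_def)
      qed
      ultimately show ?thesis by simp
    qed
    then have "\<bar>int t - 2 * int n\<bar> \<ge> int m"
      using D enat by (simp add: discrepancy_at_ge_def disc)
    then consider "t \<ge> 2 * n + m" | "t + m \<le> 2 * n" by linarith
    then show ?thesis
    proof cases
      case 1
      then show ?thesis using enat nm by (intro late) auto
    next
      case 2
      then have "\<not> enat (2 * n - m) < blue_time X n \<omega>" by (simp add: enat)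
      then have "\<beta> (2 * n - m) \<ge> n" using less by simp
      then have "\<bar>discrepancy X (2 * n - m) \<omega>\<bar> \<ge> int m" using 2 by (simp add: disc of_nat_diff)
      then show ?thesis ..
    qed
  qed
qed

theorem lemma3p1:
  fixes \<alpha> B :: real and w :: "nat \<Rightarrow> real" and t :: urn_type
    and M :: "'a measure" and X :: "nat \<Rightarrow> 'a \<Rightarrow> nat \<times> nat"
  assumes "\<alpha> > 0"
    and "\<And>n. w n > 0"
    and "\<exists>e. e \<in> O(\<lambda>n. 1 / (real n)\<^sup>2) \<and>
           (\<forall>\<^sub>F n in sequentially. 1 / w n = real n powr \<alpha> * (1 + 2 * B / real n + e n))"
    and "urn_process_of_type M t w X"
  shows "\<exists>C\<^sub>1 c\<^sub>1 :: real. C\<^sub>1 > 0 \<and> c\<^sub>1 > 0 \<and>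
    (\<forall>n m :: nat. n \<ge> 1 \<longrightarrow> m \<ge> 1 \<longrightarrow>
       \<P>(\<omega> in M. discrepancy_at_ge X (blue_time X n) m \<omega>)
         \<le> C\<^sub>1 * exp (- c\<^sub>1 * (real m)\<^sup>2 / real (max m n)) \<and>
       \<P>(\<omega> in M. \<bar>discrepancy X n \<omega>\<bar> \<ge> int m)
         \<le> C\<^sub>1 * exp (- c\<^sub>1 * (real m)\<^sup>2 / real (max m n)))"
proof -
  note pos = assms(2)
  define b where "b = blue_weight t w"
  define r where "r = red_weight t w"
  have urn: "urn_process M b r X"
    using assms(4) by (simp add: urn_process_of_type_def b_def r_def)
  have mc: "markov_chain_from M (urn_transition b r) (0, 0) X"
    using urn by (simp add: urn_process_def)
  interpret prob_space M using mc by (simp add: markov_chain_from_def)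
  obtain L where "L > 0" "\<forall>\<^sub>F n in sequentially. \<bar>real n powr \<alpha> * w n - 1\<bar> \<le> L / real n"
    using assms(3) scaled_weight_near_one[of w, OF pos] by blast
  then obtain C where C: "C > 0"
      "\<And>p q. p \<le> q + 1 \<Longrightarrow> w q \<le> w p * (1 + C / real (p + q + 1))"
    using weight_ratio_le[of \<alpha> w, OF assms(1) pos] by blast
  have bpos: "b i > 0" and rpos: "r i > 0" for i
    using pos by (cases t; simp add: b_def r_def)+
  have C0: "C \<ge> 0" using C by simp
  have red: "r j \<le> b i * (1 + C / real (i + j + 1))" if "i \<le> j" for i j
    unfolding b_def r_def by (rule urn_drift_outward_le[OF C(2) C0 pos that])
  have blue: "b i \<le> r j * (1 + C / real (i + j + 1))" if "j \<le> i" for i j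
    unfolding b_def r_def by (rule urn_drift_outward_le[OF C(2) C0 pos that])
  define K where "K = 2 * exp (4 * C\<^sup>2)"
  \<comment> \<open>Both deterministic times below are at most \<open>3 * max m n\<close>, which turns the rate \<open>1/4\<close> into \<open>1/12\<close>.\<close>
  have tail: "\<P>(\<omega> in M. \<bar>discrepancy X k \<omega>\<bar> \<ge> int m) \<le> K * exp (- (1 / 12) * (real m)\<^sup>2 / real (max m n))"
    if "k \<le> 3 * max m n" "m \<ge> 1" for k m n
  proof -
    have "\<P>(\<omega> in M. \<bar>discrepancy X k \<omega>\<bar> \<ge> int m)
        \<le> K * exp (- ((real m)\<^sup>2 / (4 * real (3 * max m n))))"
      unfolding K_def
      by (rule urn_discrepancy_tail[OF urn bpos rpos C0 red blue]) (use that in auto)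
    then show ?thesis by simp
  qed
  have K: "K > 0" by (simp add: K_def)
  show ?thesis
  proof (rule exI[of _ "2 * K"], rule exI[of _ "1 / 12"], intro conjI allI impI)
    fix n m :: nat assume nm: "n \<ge> 1" "m \<ge> 1"
    define R where "R = exp (- (1 / 12) * (real m)\<^sup>2 / real (max m n))"
    define E where "E k = {\<omega> \<in> space M. \<bar>discrepancy X k \<omega>\<bar> \<ge> int m}" for k
    have E[measurable]: "E k \<in> sets M" for k
      unfolding E_def by (rule urn_process_discrepancy_sets[OF urn])
    have ER: "measure M (E k) \<le> K * R" if "k \<le> 3 * max m n" for k
      using tail[OF that nm(2)] by (simp add: E_def R_def)
    have "measure M {\<omega> \<in> space M. discrepancy_at_ge X (blue_time X n) m \<omega>}
        \<le> measure M (E (2 * n + m - 1) \<union> E (2 * n - m))"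
    proof (rule finite_measure_mono_AE)
      show "AE \<omega> in M. \<omega> \<in> {\<omega> \<in> space M. discrepancy_at_ge X (blue_time X n) m \<omega>} \<longrightarrow>
          \<omega> \<in> E (2 * n + m - 1) \<union> E (2 * n - m)"
        using urn_process_draws_single_balls[OF urn]
      proof eventually_elim
        case (elim \<omega>)
        then show ?case
          using discrepancy_at_blue_time_imp[of X \<omega> n m] nm by (auto simp: E_def)
      qed
    qed simp
    also have "\<dots> \<le> measure M (E (2 * n + m - 1)) + measure M (E (2 * n - m))"
      by (rule measure_Un_le) auto
    also have "\<dots> \<le> K * R + K * R" by (intro add_mono ER) auto
    finally show "\<P>(\<omega> in M. discrepancy_at_ge X (blue_time X n) m \<omega>)
        \<le> 2 * K * exp (- (1 / 12) * (real m)\<^sup>2 / real (max m n))"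
      by (simp add: R_def)
    have "measure M (E n) \<le> K * R" by (rule ER) simp
    also have "\<dots> \<le> 2 * K * R" using K by (simp add: R_def)
    finally show "\<P>(\<omega> in M. \<bar>discrepancy X n \<omega>\<bar> \<ge> int m)
        \<le> 2 * K * exp (- (1 / 12) * (real m)\<^sup>2 / real (max m n))"
      by (simp add: E_def R_def)
  qed (use K in auto)
qed

end
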